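(* Let $\Sigma$ be an alphabet, $L\subseteq\Sigma^*$ a language and $0<p<1$. Then almost surely the random language $L^{\rightarrow p}$ is not a recursively enumerable language.
   Context: An alphabet is a nonempty finite set; $\Sigma^*$ is the set of finite words over $\Sigma$; a language over $\Sigma$ is any subset of $\Sigma^*$. A random language $R\subseteq\Sigma^*$ is determined by a random process: for each $w\in\Sigma^*$, the membership $w\in R$ is determined independently at random, once and for all, according to some given probability $\mathbf{Pr}(w\in R)\in[0,1]$; i.e. the events $\{w\in R\}$, $w\in\Sigma^*$, are mutually independent with the prescribed probabilities. Noisy output: for a language $L\subseteq\Sigma^*$ and $0<p<1$, $L^{\rightarrow p}$ is the random language that flips the classification of each word with respect to $L$ with probability $p$, that is, for all $w\in\Sigma^*$, $$\mathbf{Pr}(w\in L^{\rightarrow p})=(1-p)\,\mathbf{1}_{w\in L}+p\,\mathbf{1}_{w\notin L},$$ where $\mathbf{1}_C$ is $1$ if condition $C$ holds and $0$ otherwise. *)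

theory Defs
  imports "HOL-Probability.Probability"
begin

section \<open>Recursively enumerable languages\<close>

text \<open>Deterministic one-tape Turing machines on a two-way infinite tape. An alphabet is a nonempty
  finite set \<open>\<Sigma>\<close>, and \<open>lists \<Sigma>\<close> is the set of words over it. Words are stored on the tape via
  \<open>Input\<close>, so the blank is never an input symbol. States and auxiliary tape symbols are named by
  natural numbers.\<close>

datatype 'a tape_symbol = Blank | Input 'a | Aux nat

datatype direction = Left | Stay | Right

fun displacement :: "direction \<Rightarrow> int" where
  "displacement Left = -1"
| "displacement Stay = 0"
| "displacement Right = 1"

record 'a turing_machine =
  states :: "nat set"
  aux_symbols :: "nat set"
  transition :: "nat \<times> 'a tape_symbol \<rightharpoonup> nat \<times> 'a tape_symbol \<times> direction"
  start_state :: nat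
  accepting_states :: "nat set"

definition tape_alphabet :: "'a set \<Rightarrow> 'a turing_machine \<Rightarrow> 'a tape_symbol set" where
  "tape_alphabet \<Sigma> T = insert Blank (Input ` \<Sigma> \<union> Aux ` aux_symbols T)"

definition is_turing_machine :: "'a set \<Rightarrow> 'a turing_machine \<Rightarrow> bool" where
  "is_turing_machine \<Sigma> T \<longleftrightarrow>
     finite (states T) \<and> finite (aux_symbols T) \<and>
     start_state T \<in> states T \<and> accepting_states T \<subseteq> states T \<and>
     dom (transition T) \<subseteq> states T \<times> tape_alphabet \<Sigma> T \<and>
     ran (transition T) \<subseteq> states T \<times> tape_alphabet \<Sigma> T \<times> UNIV"

text \<open>A configuration consists of the current state, the head position and the tape contents.\<close>

type_synonym 'a configuration = "nat \<times> int \<times> (int \<Rightarrow> 'a tape_symbol)"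

definition initial_configuration :: "'a turing_machine \<Rightarrow> 'a list \<Rightarrow> 'a configuration" where
  "initial_configuration T w =
     (start_state T, 0, \<lambda>i. if 0 \<le> i \<and> i < int (length w) then Input (w ! nat i) else Blank)"

inductive step :: "'a turing_machine \<Rightarrow> 'a configuration \<Rightarrow> 'a configuration \<Rightarrow> bool" for T where
  "transition T (q, tape i) = Some (q', s, d) \<Longrightarrow>
     step T (q, i, tape) (q', i + displacement d, tape(i := s))"

text \<open>Acceptance is by reaching an accepting state; on other words the machine may halt or run
  forever.\<close>

definition accepts :: "'a turing_machine \<Rightarrow> 'a list \<Rightarrow> bool" where
  "accepts T w \<longleftrightarrow>
     (\<exists>q i tape. (step T)\<^sup>*\<^sup>* (initial_configuration T w) (q, i, tape) \<and> q \<in> accepting_states T)"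

definition recursively_enumerable :: "'a set \<Rightarrow> 'a list set \<Rightarrow> bool" where
  "recursively_enumerable \<Sigma> L \<longleftrightarrow>
     (\<exists>T. is_turing_machine \<Sigma> T \<and> L = {w \<in> lists \<Sigma>. accepts T w})"

section \<open>Random languages\<close>

text \<open>\<open>R\<close> is a language-valued random variable on an arbitrary probability space \<open>M\<close>, with
  \<open>P w\<close> the prescribed probability of \<open>w \<in> R\<close>. Measurability of the events \<open>w \<in> R\<close> is part of
  \<^const>\<open>prob_space.indep_events\<close>, which is mutual independence.\<close>

definition random_language ::
    "'b measure \<Rightarrow> 'a set \<Rightarrow> ('a list \<Rightarrow> real) \<Rightarrow> ('b \<Rightarrow> 'a list set) \<Rightarrow> bool" where
  "random_language M \<Sigma> P R \<longleftrightarrow>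
     prob_space M \<and>
     (\<forall>\<omega>\<in>space M. R \<omega> \<subseteq> lists \<Sigma>) \<and>
     prob_space.indep_events M (\<lambda>w. {\<omega> \<in> space M. w \<in> R \<omega>}) (lists \<Sigma>) \<and>
     (\<forall>w\<in>lists \<Sigma>. measure M {\<omega> \<in> space M. w \<in> R \<omega>} = P w)"

text \<open>\<open>R\<close> is a version of the noisy output language \<open>L\<^sup>\<rightarrow>\<^sup>p\<close>.\<close>

definition noisy_output ::
    "'b measure \<Rightarrow> 'a set \<Rightarrow> 'a list set \<Rightarrow> real \<Rightarrow> ('b \<Rightarrow> 'a list set) \<Rightarrow> bool" where
  "noisy_output M \<Sigma> L p R \<longleftrightarrow>
     random_language M \<Sigma> (\<lambda>w. (1 - p) * of_bool (w \<in> L) + p * of_bool (w \<notin> L)) R"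

end

theory Submission
  imports Defs
begin

text \<open>There are only countably many Turing machines over \<open>\<Sigma>\<close>, hence countably many recursively
  enumerable languages, and the random language equals any fixed language with probability \<open>0\<close>: by
  independence it agrees with it on \<open>n\<close> given words with probability at most \<open>(max p (1 - p))\<^sup>n\<close>.\<close>

text \<open>A partial map is determined by its graph, which here is a finite subset of the countable
  set \<open>A \<times> B\<close>; a countable set has only countably many finite subsets.\<close>

lemma countable_maps_finite_dom:
  assumes "countable A" and "countable B"
  shows "countable {f. finite (dom f) \<and> dom f \<subseteq> A \<and> ran f \<subseteq> B}" (is "countable ?F")
proof (rule countable_image_inj_on)
  show "inj_on Map.graph ?F"
    by (auto intro!: inj_onI ext simp: Map.graph_def set_eq_iff) (metis not_None_eq)
  have "finite (Map.graph f)" "Map.graph f \<subseteq> A \<times> B" if "f \<in> ?F" for f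
    using that by (auto simp: graph_eq_to_snd_dom ran_def)
  then have "Map.graph ` ?F \<subseteq> {G. finite G \<and> G \<subseteq> A \<times> B}"
    by blast
  moreover have "countable {G. finite G \<and> G \<subseteq> A \<times> B}"
    using assms by (intro countable_Collect_finite_subset countable_SIGMA) auto
  ultimately show "countable (Map.graph ` ?F)"
    using countable_subset by blast
qed

lemma countable_turing_machines:
  assumes "finite \<Sigma>"
  shows "countable {T. is_turing_machine \<Sigma> T}"
proof -
  \<comment> \<open>The tape alphabet varies with the machine; \<open>?S\<close> is one countable
    set that contains all of them, so a single set \<open>?F\<close> holds the transition maps of
    all machines.\<close>
  let ?S = "insert Blank (Input ` \<Sigma> \<union> range Aux)"
  let ?N = "{A :: nat set. finite A}"
  let ?F = "{f. finite (dom f) \<and> dom f \<subseteq> UNIV \<times> ?S \<and> ran f \<subseteq> UNIV \<times> ?S \<times> UNIV}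
    :: (nat \<times> 'a tape_symbol \<rightharpoonup> nat \<times> 'a tape_symbol \<times> direction) set"
  let ?g = "\<lambda>(Q, A, f, q, E).
    \<lparr>states = Q, aux_symbols = A, transition = f, start_state = q, accepting_states = E\<rparr>"
  have "countable (UNIV :: direction set)"
  proof -
    have "(UNIV :: direction set) = {Left, Stay, Right}"
      using direction.exhaust by blast
    then show ?thesis by (metis countable_finite finite.emptyI finite.insertI)
  qed
  then have "countable ?F"
    using assms by (intro countable_maps_finite_dom countable_SIGMA) (auto intro: countable_finite)
  then have "countable (?g ` (?N \<times> ?N \<times> ?F \<times> UNIV \<times> ?N))"
    by (intro countable_image countable_SIGMA countable_Collect_finite) auto
  moreover have "{T. is_turing_machine \<Sigma> T} \<subseteq> ?g ` (?N \<times> ?N \<times> ?F \<times> UNIV \<times> ?N)"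
  proof (intro subsetI image_eqI)
    fix T
    assume "T \<in> {T. is_turing_machine \<Sigma> T}"
    then have T: "is_turing_machine \<Sigma> T" by simp
    let ?t = "(states T, aux_symbols T, transition T, start_state T, accepting_states T)"
    show "T = ?g ?t" by simp
    have sub: "tape_alphabet \<Sigma> T \<subseteq> ?S" and fin: "finite (tape_alphabet \<Sigma> T)"
      using T assms by (auto simp: is_turing_machine_def tape_alphabet_def)
    \<comment> \<open>The domain lies in the product of the finite state set and the tape alphabet,
      which is finite because \<Sigma> is.\<close>
    have "finite (dom (transition T))"
      using T fin unfolding is_turing_machine_def by (meson finite_SigmaI finite_subset)
    moreover have "dom (transition T) \<subseteq> UNIV \<times> ?S" "ran (transition T) \<subseteq> UNIV \<times> ?S \<times> UNIV"
      using T sub unfolding is_turing_machine_def by blast+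
    ultimately show "?t \<in> ?N \<times> ?N \<times> ?F \<times> UNIV \<times> ?N"
      using T by (auto simp: is_turing_machine_def intro: finite_subset)
  qed
  ultimately show ?thesis
    by (rule countable_subset[rotated])
qed

lemma countable_recursively_enumerable:
  assumes "finite \<Sigma>"
  shows "countable {L. recursively_enumerable \<Sigma> L}"
proof -
  have "{L. recursively_enumerable \<Sigma> L}
      = (\<lambda>T. {w \<in> lists \<Sigma>. accepts T w}) ` {T. is_turing_machine \<Sigma> T}"
    by (auto simp: recursively_enumerable_def)
  then show ?thesis
    using countable_turing_machines[OF assms] by simp
qed

context prob_space
begin

text \<open>Independence of the one-element families \<open>{A i}\<close>, which are closed under
  intersection, passes to the sigma-algebras they generate, and these contain the
  complements.\<close>

lemma indep_events_flip:
  assumes "indep_events A I"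
  shows "indep_events (\<lambda>i. if i \<in> J then A i else space M - A i) I"
proof -
  have "indep_sets (\<lambda>i. {A i}) I"
    using assms by (simp add: indep_events_def_alt)
  then have "indep_sets (\<lambda>i. sigma_sets (space M) {A i}) I"
    by (intro indep_sets_sigma) (auto simp: Int_stable_def)
  then have "indep_sets (\<lambda>i. {if i \<in> J then A i else space M - A i}) I"
    by (rule indep_sets_mono_sets) (auto intro: sigma_sets.intros)
  then show ?thesis
    by (simp add: indep_events_def_alt)
qed

text \<open>For every \<open>n\<close>, some \<open>n\<close> of the events can be selected; by
  independence they occur jointly with probability at most \<open>q ^ n\<close>, which tends to 0.
  Countability of \<open>I\<close> makes the whole intersection measurable.\<close>

lemma prob_INT_indep_events_eq_0:
  assumes "indep_events A I" and "countable I" and "infinite I"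
    and "q < 1" and le: "\<And>i. i \<in> I \<Longrightarrow> prob (A i) \<le> q"
  shows "(\<Inter>i\<in>I. A i) \<in> null_sets M"
proof -
  have A: "A i \<in> events" if "i \<in> I" for i
    using assms(1) that by (auto simp: indep_events_def)
  have "I \<noteq> {}" using \<open>infinite I\<close> by auto
  with A \<open>countable I\<close> have ev: "(\<Inter>i\<in>I. A i) \<in> events"
    by (intro sets.countable_INT') auto
  have q0: "0 \<le> q"
    using le \<open>I \<noteq> {}\<close> by (meson all_not_in_conv measure_nonneg order_trans)
  have "prob (\<Inter>i\<in>I. A i) \<le> q ^ n" for n
  \<comment> \<open>The product formula for independent events is stated for nonempty finite index
    sets; for \<open>n = 0\<close> the bound is just 1.\<close>
  proof (cases "n = 0")
    case False
    obtain J where J: "J \<subseteq> I" "finite J" "card J = n"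
      using infinite_arbitrarily_large[OF \<open>infinite I\<close>] by metis
    with False have "J \<noteq> {}" by auto
    have "prob (\<Inter>i\<in>I. A i) \<le> prob (\<Inter>i\<in>J. A i)"
      using J A \<open>J \<noteq> {}\<close> by (intro finite_measure_mono sets.finite_INT) auto
    also have "\<dots> = (\<Prod>i\<in>J. prob (A i))"
      using assms(1) J \<open>J \<noteq> {}\<close> by (auto simp: indep_events_def)
    also have "\<dots> \<le> (\<Prod>i\<in>J. q)"
      using le J by (intro prod_mono) auto
    finally show ?thesis using J by simp
  qed simp
  moreover have "(\<lambda>n. q ^ n) \<longlonglongrightarrow> 0"
    using q0 \<open>q < 1\<close> by (intro LIMSEQ_realpow_zero)
  ultimately have "prob (\<Inter>i\<in>I. A i) \<le> 0"
    by (meson LIMSEQ_le_const)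
  then have "prob (\<Inter>i\<in>I. A i) = 0"
    by (simp add: measure_le_0_iff)
  with ev show ?thesis
    by (auto simp: null_sets_def emeasure_eq_measure)
qed

end

lemma infinite_lists:
  assumes "A \<noteq> {}"
  shows "infinite (lists A)"
proof -
  obtain a where "a \<in> A" using assms by blast
  then have "range (\<lambda>n. replicate n a) \<subseteq> lists A" by auto
  moreover have "inj (\<lambda>n. replicate n a)"
    by (rule injI) (metis length_replicate)
  ultimately show ?thesis
    using finite_subset range_inj_infinite by blast
qed

text \<open>If \<open>R \<omega> = K\<close>, then \<omega> lies in every \<open>?B w\<close>, the
  event that \<open>R\<close> and \<open>K\<close> agree on \<open>w\<close>. Its probability is
  \<open>P w\<close> or \<open>1 - P w\<close> according to whether \<open>w\<close> is in
  \<open>K\<close>, hence the two-sided bound by \<open>q\<close>.\<close>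

lemma AE_random_language_neq:
  assumes R: "random_language M \<Sigma> P R" and "countable \<Sigma>" and "\<Sigma> \<noteq> {}" and "q < 1"
    and P: "\<And>w. w \<in> lists \<Sigma> \<Longrightarrow> P w \<le> q \<and> 1 - P w \<le> q"
  shows "AE \<omega> in M. R \<omega> \<noteq> K"
proof -
  interpret prob_space M using R by (simp add: random_language_def)
  let ?A = "\<lambda>w. {\<omega> \<in> space M. w \<in> R \<omega>}"
  let ?B = "\<lambda>w. if w \<in> K then ?A w else space M - ?A w"
  have ind: "indep_events ?A (lists \<Sigma>)" and pr: "\<And>w. w \<in> lists \<Sigma> \<Longrightarrow> prob (?A w) = P w"
    using R by (auto simp: random_language_def)
  have "prob (?B w) \<le> q" if "w \<in> lists \<Sigma>" for w
  proof -
    have "?A w \<in> events" using ind that by (auto simp: indep_events_def)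
    then show ?thesis using P[OF that] pr[OF that] by (simp add: prob_compl)
  qed
  moreover have "infinite (lists \<Sigma>)" "countable (lists \<Sigma>)"
    using assms by (auto simp: infinite_lists)
  ultimately have "(\<Inter>w\<in>lists \<Sigma>. ?B w) \<in> null_sets M"
    using \<open>q < 1\<close> indep_events_flip[OF ind]
    by (intro prob_INT_indep_events_eq_0[where q = q]) auto
  then show ?thesis
    by (rule AE_I') auto
qed

theorem theorem4p2:
  fixes \<Sigma> :: "'a set" and L :: "'a list set" and p :: real
    and M :: "'b measure" and R :: "'b \<Rightarrow> 'a list set"
  assumes "finite \<Sigma>" and "\<Sigma> \<noteq> {}"
    and "L \<subseteq> lists \<Sigma>"
    and "0 < p" and "p < 1"
    and "noisy_output M \<Sigma> L p R"
  shows "AE \<omega> in M. \<not> recursively_enumerable \<Sigma> (R \<omega>)"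
proof -
  have "AE \<omega> in M. R \<omega> \<noteq> K" for K
    \<comment> \<open>Each prescribed probability is \<open>p\<close> or \<open>1 - p\<close>, and
      so is its complement to 1; the larger of the two is below 1 because \<open>0 < p\<close> and
      \<open>p < 1\<close>.\<close>
    using assms unfolding noisy_output_def
    by (intro AE_random_language_neq[where q = "max p (1 - p)"])
      (auto simp: countable_finite)
  \<comment> \<open>The exceptional null set depends on \<open>K\<close>; a countable union of such
    sets is still null.\<close>
  then have "AE \<omega> in M. \<forall>K\<in>{K. recursively_enumerable \<Sigma> K}. R \<omega> \<noteq> K"
    using countable_recursively_enumerable[OF \<open>finite \<Sigma>\<close>] by (simp only: AE_ball_countable) simp
  then show ?thesis
    by eventually_elim auto
qed

end
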